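(* There is an absolute constant $c>0$ such that for every field $K$ of characteristic zero and every finite subset $A\subset K$ with $|A|\ge 2$, $$\max\{|A+A|,\ |A\cdot A|\}\ \ge\ c\,\frac{|A|^{4/3}}{(\log|A|)^{1/3}}.$$
   Context: For a finite set $A\subset K$, $A+A=\{a+b : a,b\in A\}$ and $A\cdot A=\{ab : a,b\in A\}$. *)

theory Defs
  imports Complex_Main "HOL-Library.Set_Algebras"
begin

text \<open>
  For \<open>A :: 'a set\<close>, the library's \<open>A + A\<close> and \<open>A * A\<close> are the sumset and the product set.

  A HOL formula cannot quantify over types, so in \<open>\<exists>c>0. \<forall>A :: 'a set. \<dots>\<close> the constant would be
  allowed to depend on the field \<open>'a\<close>.  The absolute constant is therefore a closed term of
  type \<open>real\<close>, in which no type variable occurs, and a polymorphic bound in terms of it is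
  uniform over all fields.  It is picked by Hilbert choice among the constants that are
  admissible for the complex numbers.  No value is prescribed, and if any absolute constant
  exists, this one is positive and works for every field of characteristic zero, because
  every finitely generated such field embeds into the complex numbers.
  If there were no admissible constant, nothing could be proved about the chosen number; in
  particular its positivity is not built into the definition.
\<close>

definition sum_product_const :: real where
  "sum_product_const = (SOME c. c > 0 \<and>
     (\<forall>A :: complex set. finite A \<and> card A \<ge> 2 \<longrightarrow>
        real (max (card (A + A)) (card (A * A)))
          \<ge> c * (real (card A) powr (4 / 3) / ln (real (card A)) powr (1 / 3))))"

end

(*
  Over the complex numbers, restrict A to a quadrant and adapt Solymosi's argument: let r(l) be
  the number of points of A x A on the line of slope l. Join each of the N lines with r(l) >= k
  to the line whose slope m is nearest. As A lies in a quadrant, all sums of a point on the first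
  and a point on the second line have a slope in the disc around l of radius |l - m|. Any point
  of the plane lies in at most 9 of these discs, so N k^2 <= 9 |A + A|^2. Summing over k bounds
  the multiplicative energy, the sum of the r(l)^2, by |A + A|^2 log |A| up to a constant, and
  by Cauchy-Schwarz the energy is at least |A|^4 / |A * A|.

  A finite subset of any field of characteristic zero lies in a countable subring that embeds into
  the complex numbers; one adjoins its elements one at a time, choosing as image a conjugate root
  in the algebraic case and any number outside a countable set in the transcendental case.
*)

theory Submission
  imports Defs "HOL-Analysis.Analysis" "HOL-Computational_Algebra.Fundamental_Theorem_Algebra"
begin

section \<open>Embedding finitely generated subrings into the complex numbers\<close>

locale subring =
  fixes R :: "'a :: field_char_0 set"
  assumes one_mem [simp]: "1 \<in> R"
    and diff_mem [simp]: "\<And>a b. a \<in> R \<Longrightarrow> b \<in> R \<Longrightarrow> a - b \<in> R"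
    and mult_mem [simp]: "\<And>a b. a \<in> R \<Longrightarrow> b \<in> R \<Longrightarrow> a * b \<in> R"
begin

lemma zero_mem [simp]: "0 \<in> R"
  using diff_mem[OF one_mem one_mem] by simp

lemma add_mem [simp]: "a \<in> R \<Longrightarrow> b \<in> R \<Longrightarrow> a + b \<in> R"
  using diff_mem[OF _ diff_mem[OF zero_mem], of a b] by simp

lemma sum_mem: "(\<And>i. i \<in> I \<Longrightarrow> f i \<in> R) \<Longrightarrow> sum f I \<in> R"
  by (induction I rule: infinite_finite_induct) auto

definition polys :: "'a poly set" where
  "polys = {p. \<forall>i. coeff p i \<in> R}"

lemma polysI: "(\<And>i. coeff p i \<in> R) \<Longrightarrow> p \<in> polys"
  by (simp add: polys_def)

lemma coeff_polys [simp]: "p \<in> polys \<Longrightarrow> coeff p i \<in> R"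
  by (simp add: polys_def)

lemma polys_closed [simp]:
  shows "0 \<in> polys" "a \<in> R \<Longrightarrow> [:a:] \<in> polys" "a \<in> R \<Longrightarrow> monom a n \<in> polys"
    "p \<in> polys \<Longrightarrow> q \<in> polys \<Longrightarrow> p + q \<in> polys"
    "p \<in> polys \<Longrightarrow> q \<in> polys \<Longrightarrow> p - q \<in> polys"
    "p \<in> polys \<Longrightarrow> q \<in> polys \<Longrightarrow> p * q \<in> polys"
    "a \<in> R \<Longrightarrow> p \<in> polys \<Longrightarrow> smult a p \<in> polys"
  by (auto simp: coeff_mult coeff_pCons split: nat.split intro!: polysI sum_mem)

lemma one_polys [simp]: "1 \<in> polys"
  by (simp add: one_pCons)

lemma countable_polys:
  assumes "countable R"
  shows "countable polys"
proof -
  have "p \<in> Poly ` lists R" if "p \<in> polys" for p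
  proof
    show "p = Poly (coeffs p)"
      by simp
    show "coeffs p \<in> lists R"
      using that by (auto simp: coeffs_def in_lists_conv_set)
  qed
  hence "polys \<subseteq> Poly ` lists R"
    by blast
  thus ?thesis
    by (rule countable_subset) (use assms in auto)
qed

text \<open>\<open>R\<close> need not be a field, so the leading coefficient of \<open>p\<close>
  cannot be divided out. Each step of the long division multiplies \<open>q\<close> by it instead,
  and these factors accumulate in \<open>c\<close>.\<close>

lemma pseudo_division:
  assumes "p \<in> polys" "p \<noteq> 0" "q \<in> polys"
  obtains c h r where "c \<in> R" "c \<noteq> 0" "h \<in> polys" "r \<in> polys"
    "smult c q = p * h + r" "r = 0 \<or> degree r < degree p"
proof -
  have "\<exists>c h r. c \<in> R \<and> c \<noteq> 0 \<and> h \<in> polys \<and> r \<in> polys \<and>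
      smult c q = p * h + r \<and> (r = 0 \<or> degree r < degree p)"
    using assms(3)
  proof (induction "degree q" arbitrary: q rule: less_induct)
    case (less q)
    show ?case
    proof (cases "degree q < degree p \<or> q = 0")
      case True
      thus ?thesis
        using less.prems by (intro exI[of _ 1] exI[of _ 0] exI[of _ q]) auto
    next
      case False
      define m where "m = monom (lead_coeff q) (degree q - degree p)"
      define q1 where "q1 = smult (lead_coeff p) q - p * m"
      have m: "m \<in> polys"
        using less.prems by (simp add: m_def)
      have q1: "q1 \<in> polys"
        using less.prems assms m by (simp add: q1_def)
      have deg_m: "degree (p * m) = degree q"
        using False assms(2) by (simp add: m_def degree_mult_eq degree_monom_eq)
      have deg: "degree q1 < degree q \<or> q1 = 0"
      proof -
        have "lead_coeff (p * m) = lead_coeff p * lead_coeff q"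
          by (simp add: lead_coeff_mult m_def del: coeff_monom)
        hence "coeff q1 (degree q) = 0"
          using deg_m by (simp add: q1_def)
        moreover have "degree q1 \<le> degree q"
          unfolding q1_def using deg_m by (intro degree_diff_le) auto
        ultimately show ?thesis
          by (metis leading_coeff_0_iff le_neq_implies_less)
      qed
      show ?thesis
      proof (cases "q1 = 0")
        case True
        thus ?thesis
          using assms m by (intro exI[of _ "lead_coeff p"] exI[of _ m] exI[of _ 0]) (auto simp: q1_def)
      next
        case False
        then obtain c h r where chr: "c \<in> R" "c \<noteq> 0" "h \<in> polys" "r \<in> polys"
          "smult c q1 = p * h + r" "r = 0 \<or> degree r < degree p"
          using less.hyps[OF _ q1] deg by blast
        have "smult (c * lead_coeff p) q = p * (h + smult c m) + r"
          using chr(5) by (simp add: q1_def smult_diff_right algebra_simps)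
        thus ?thesis
          using chr assms m
          by (intro exI[of _ "c * lead_coeff p"] exI[of _ "h + smult c m"] exI[of _ r]) auto
      qed
    qed
  qed
  thus ?thesis
    using that by blast
qed

end

section \<open>Ring embeddings into the complex numbers and the adjunction of one element\<close>

text \<open>Only the values of \<open>\<phi>\<close> on \<open>R\<close> are constrained; the
  trivial kernel makes it injective there. Working with rings avoids extending maps to
  inverses.\<close>

locale subring_embedding = subring R for R :: "'a :: field_char_0 set" +
  fixes \<phi> :: "'a \<Rightarrow> complex"
  assumes map_1 [simp]: "\<phi> 1 = 1"
    and map_diff [simp]: "\<And>a b. a \<in> R \<Longrightarrow> b \<in> R \<Longrightarrow> \<phi> (a - b) = \<phi> a - \<phi> b"
    and map_mult [simp]: "\<And>a b. a \<in> R \<Longrightarrow> b \<in> R \<Longrightarrow> \<phi> (a * b) = \<phi> a * \<phi> b"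
    and map_eq_0D: "\<And>a. a \<in> R \<Longrightarrow> \<phi> a = 0 \<Longrightarrow> a = 0"
begin

lemma map_0 [simp]: "\<phi> 0 = 0"
  using map_diff[of 0 0] by simp

lemma map_eq_0_iff [simp]: "a \<in> R \<Longrightarrow> \<phi> a = 0 \<longleftrightarrow> a = 0"
  using map_eq_0D by auto

lemma map_add [simp]: "a \<in> R \<Longrightarrow> b \<in> R \<Longrightarrow> \<phi> (a + b) = \<phi> a + \<phi> b"
  using map_diff[OF _ diff_mem[OF zero_mem], of a b] map_diff[of 0 b] by simp

lemma map_sum: "(\<And>i. i \<in> I \<Longrightarrow> f i \<in> R) \<Longrightarrow> \<phi> (sum f I) = (\<Sum>i\<in>I. \<phi> (f i))"
  by (induction I rule: infinite_finite_induct) (auto simp: sum_mem)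

lemma inj_on_map: "inj_on \<phi> R"
  by (rule inj_onI) (metis map_diff diff_mem map_eq_0_iff right_minus_eq)

abbreviation map_p :: "'a poly \<Rightarrow> complex poly" where
  "map_p \<equiv> map_poly \<phi>"

lemma coeff_map_p [simp]: "coeff (map_p p) i = \<phi> (coeff p i)"
  by (simp add: coeff_map_poly)

lemma map_p_hom [simp]:
  shows "p \<in> polys \<Longrightarrow> q \<in> polys \<Longrightarrow> map_p (p + q) = map_p p + map_p q"
    "p \<in> polys \<Longrightarrow> q \<in> polys \<Longrightarrow> map_p (p - q) = map_p p - map_p q"
    "a \<in> R \<Longrightarrow> p \<in> polys \<Longrightarrow> map_p (smult a p) = smult (\<phi> a) (map_p p)"
    "p \<in> polys \<Longrightarrow> q \<in> polys \<Longrightarrow> map_p (p * q) = map_p p * map_p q"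
    "map_p [:a:] = [:\<phi> a:]"
  by (auto intro!: poly_eqI sum.cong simp: coeff_mult map_sum coeff_pCons split: nat.split)

lemma degree_map_p: "p \<in> polys \<Longrightarrow> degree (map_p p) = degree p"
  by (cases "p = 0") (simp_all add: map_poly_degree_eq)

lemma map_p_eq_0_iff: "p \<in> polys \<Longrightarrow> map_p p = 0 \<longleftrightarrow> p = 0"
  by (metis coeff_0 coeff_map_p coeff_polys map_eq_0_iff poly_eqI)

text \<open>A polynomial whose image vanishes at \<open>z\<close> but which does not vanish at \<open>x\<close> can, by dividing by
  a minimal annihilator \<open>p\<close> of \<open>x\<close>, be taken of degree less than \<open>p\<close>; dividing \<open>p\<close> by one of
  minimal degree then gives a factorisation of \<open>p\<close>, one factor of which annihilates \<open>x\<close>.\<close>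

lemma conjugate_root_algebraic:
  assumes "p0 \<in> polys" "p0 \<noteq> 0" "poly p0 x = 0"
  shows "\<exists>z. \<forall>q\<in>polys. poly q x = 0 \<longleftrightarrow> poly (map_p q) z = 0"
proof -
  define Q where "Q = (\<lambda>p. p \<in> polys \<and> p \<noteq> 0 \<and> poly p x = 0)"
  define p where "p = arg_min degree Q"
  have "Q p" and p_min: "\<And>q. Q q \<Longrightarrow> degree p \<le> degree q"
    using arg_min_nat_lemma[of Q p0 degree] assms by (auto simp: p_def Q_def)
  hence p: "p \<in> polys" "p \<noteq> 0" "poly p x = 0"
    by (auto simp: Q_def)
  have small: "r = 0" if "r \<in> polys" "poly r x = 0" "degree r < degree p" for r
    using p_min[of r] that by (force simp: Q_def)
  have "degree p \<noteq> 0"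
    using p(2,3) by (metis degree_eq_zeroE pCons_0_0 poly_const_conv)
  hence "\<not> constant (poly (map_p p))"
    by (simp add: constant_degree degree_map_p p)
  then obtain z where z: "poly (map_p p) z = 0"
    using fundamental_theorem_of_algebra by blast
  have root: "poly (map_p q) z = 0" if q: "q \<in> polys" "poly q x = 0" for q
  proof -
    obtain c h r where chr: "c \<in> R" "c \<noteq> 0" "h \<in> polys" "r \<in> polys"
      "smult c q = p * h + r" "r = 0 \<or> degree r < degree p"
      using pseudo_division[OF p(1,2) q(1)] .
    have "poly (smult c q) x = poly (p * h + r) x"
      using chr(5) by simp
    hence "poly r x = 0"
      using q p by simp
    hence "r = 0"
      using small chr by auto
    hence "map_p (smult c q) = map_p (p * h)"
      using chr by simp
    hence "poly (map_p (smult c q)) z = poly (map_p (p * h)) z"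
      by simp
    thus ?thesis
      using chr(1-3) q p z by simp
  qed
  define B where "B = (\<lambda>q. q \<in> polys \<and> poly q x \<noteq> 0 \<and> poly (map_p q) z = 0)"
  have "\<not> B q0" for q0
  proof
    assume q0: "B q0"
    define q where "q = arg_min degree B"
    have "B q" and q_min: "\<And>r. B r \<Longrightarrow> degree q \<le> degree r"
      using arg_min_nat_lemma[of B q0 degree] q0 by (auto simp: q_def)
    hence q: "q \<in> polys" "poly q x \<noteq> 0" "poly (map_p q) z = 0"
      by (auto simp: B_def)
    have "q \<noteq> 0"
      using q(2) by auto
    \<comment> \<open>The pseudo-remainder of \<open>q\<close> by \<open>p\<close> again satisfies
      \<open>B\<close>, so minimality puts the degree of \<open>q\<close> below that of
      \<open>p\<close>.\<close>
    have "degree q < degree p"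
    proof -
      obtain c h r where chr: "c \<in> R" "c \<noteq> 0" "h \<in> polys" "r \<in> polys"
        "smult c q = p * h + r" "r = 0 \<or> degree r < degree p"
        using pseudo_division[OF p(1,2) q(1)] .
      have r: "r = smult c q - p * h"
        using chr(5) by simp
      have "B r"
        using chr(1-4) q p z by (simp add: B_def r)
      thus ?thesis
        using q_min[of r] chr(6) by (auto simp: B_def)
    qed
    obtain c h r where chr: "c \<in> R" "c \<noteq> 0" "h \<in> polys" "r \<in> polys"
      "smult c p = q * h + r" "r = 0 \<or> degree r < degree q"
      using pseudo_division[OF q(1) \<open>q \<noteq> 0\<close> p(1)] .
    have r: "r = smult c p - q * h"
      using chr(5) by simp
    have "poly (map_p r) z = 0"
      using chr(1-4) q p z by (simp add: r)
    \<comment> \<open>A nonzero \<open>r\<close> has smaller degree than \<open>q\<close>, so it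
      does not satisfy \<open>B\<close>; as its image vanishes at \<open>z\<close>, it vanishes at
      \<open>x\<close>. Minimality of \<open>p\<close> then gives \<open>r = 0\<close>.\<close>
    hence "poly r x = 0"
      using q_min[of r] chr(4,6) poly_0 unfolding B_def by (metis not_less)
    hence "r = 0"
      using small[of r] chr \<open>degree q < degree p\<close> by auto
    hence cp: "smult c p = q * h"
      using chr by simp
    hence "poly (smult c p) x = poly (q * h) x"
      by simp
    hence "poly h x = 0"
      using p q by simp
    have "h \<noteq> 0"
      using cp chr p by auto
    \<comment> \<open>The nonzero annihilator \<open>h\<close> of \<open>x\<close> has degree at
      least that of \<open>p\<close>. So \<open>q\<close> is a constant, and the image of a nonzero
      constant cannot vanish at \<open>z\<close>.\<close>
    have "degree p = degree q + degree h"
      using arg_cong[OF cp, of degree] chr(2) \<open>q \<noteq> 0\<close> \<open>h \<noteq> 0\<close> by (simp add: degree_mult_eq)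
    hence "degree q = 0"
      using small[OF chr(3) \<open>poly h x = 0\<close>] \<open>h \<noteq> 0\<close> by auto
    then obtain d where "q = [:d:]"
      using degree_eq_zeroE by blast
    thus False
      using q coeff_polys[OF q(1), of 0] by simp
  qed
  thus ?thesis
    using root by (auto simp: B_def)
qed

text \<open>The images of the countably many nonzero polynomials have countably many roots
  altogether, so some \<open>z\<close> avoids them. Both sides of the equivalence then say
  \<open>q = 0\<close>.\<close>

lemma conjugate_root_transcendental:
  assumes "countable R" "\<And>p. p \<in> polys \<Longrightarrow> poly p x = 0 \<Longrightarrow> p = 0"
  shows "\<exists>z. \<forall>q\<in>polys. poly q x = 0 \<longleftrightarrow> poly (map_p q) z = 0"
proof -
  have "countable (\<Union>p\<in>polys - {0}. {z. poly (map_p p) z = 0})"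
    by (intro countable_UN[OF countable_Diff[OF countable_polys[OF assms(1)]]]
        countable_finite[OF poly_roots_finite]) (auto simp: map_p_eq_0_iff)
  hence "(\<Union>p\<in>polys - {0}. {z. poly (map_p p) z = 0}) \<noteq> UNIV"
    using uncountable_UNIV_complex by auto
  then obtain z where "\<And>p. p \<in> polys \<Longrightarrow> p \<noteq> 0 \<Longrightarrow> poly (map_p p) z \<noteq> 0"
    by auto
  thus ?thesis
    using assms(2) by (intro exI[of _ z]) (metis map_p_eq_0_iff poly_0)
qed

text \<open>\<open>R'\<close> is the ring R[x], and \<open>\<phi>'\<close> evaluates at the
  conjugate \<open>z\<close>. The forward direction of the equivalence makes this well defined, the
  backward one makes it injective.\<close>

lemma adjoin:
  assumes "countable R"
  shows "\<exists>R' \<phi>'. subring_embedding R' \<phi>' \<and> countable R' \<and> R \<subseteq> R' \<and> x \<in> R'"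
proof -
  obtain z where z: "\<And>q. q \<in> polys \<Longrightarrow> poly q x = 0 \<longleftrightarrow> poly (map_p q) z = 0"
    using conjugate_root_algebraic[of _ x] conjugate_root_transcendental[OF assms, of x] by metis
  define R' where "R' = (\<lambda>q. poly q x) ` polys"
  define \<phi>' where "\<phi>' = (\<lambda>y. poly (map_p (SOME q. q \<in> polys \<and> poly q x = y)) z)"
  have \<phi>': "\<phi>' (poly q x) = poly (map_p q) z" if "q \<in> polys" for q
  proof -
    define q' where "q' = (SOME q'. q' \<in> polys \<and> poly q' x = poly q x)"
    have q': "q' \<in> polys \<and> poly q' x = poly q x"
      unfolding q'_def by (rule someI[of _ q]) (use that in simp)
    hence "poly (map_p (q' - q)) z = 0"
      using z[of "q' - q"] that by simp
    thus ?thesis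
      using q' that by (simp add: \<phi>'_def q'_def)
  qed
  have mem: "poly q x \<in> R'" if "q \<in> polys" for q
    using that by (auto simp: R'_def)
  have "subring_embedding R' \<phi>'"
  proof
    show "1 \<in> R'"
      using mem[of 1] by simp
    show "\<phi>' 1 = 1"
      using \<phi>'[of 1] by simp
  next
    fix a b assume "a \<in> R'" "b \<in> R'"
    then obtain p q where pq: "p \<in> polys" "q \<in> polys" "a = poly p x" "b = poly q x"
      by (auto simp: R'_def)
    show "a - b \<in> R'" "a * b \<in> R'"
      using mem[of "p - q"] mem[of "p * q"] pq by simp_all
    show "\<phi>' (a - b) = \<phi>' a - \<phi>' b" "\<phi>' (a * b) = \<phi>' a * \<phi>' b"
      using \<phi>'[of "p - q"] \<phi>'[of "p * q"] \<phi>'[of p] \<phi>'[of q] pq by simp_all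
  next
    fix a assume "a \<in> R'" "\<phi>' a = 0"
    thus "a = 0"
      using \<phi>' z by (auto simp: R'_def)
  qed
  moreover have "countable R'"
    unfolding R'_def using countable_polys[OF assms] by simp
  moreover have "R \<subseteq> R'"
    using mem[of "[:a:]" for a] by auto
  moreover have "x \<in> R'"
    using mem[of "monom 1 1"] by (simp add: poly_monom)
  ultimately show ?thesis
    by blast
qed

end

text \<open>Base of the induction: in characteristic zero an element of \<open>\<int>\<close> comes
  from exactly one integer, which \<open>THE\<close> recovers.\<close>

lemma Ints_embedding:
  "subring_embedding (\<int> :: 'a :: field_char_0 set) (\<lambda>a. of_int (THE k. a = of_int k))"
  by unfold_locales (auto elim!: Ints_cases simp flip: of_int_diff of_int_mult)

theorem finite_subset_embeds_in_complex:
  fixes A :: "'a :: field_char_0 set"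
  assumes "finite A"
  obtains R \<phi> where "subring_embedding R \<phi>" "A \<subseteq> R"
proof -
  \<comment> \<open>Countability is carried along because \<open>adjoin\<close> requires it of the
    ring built so far.\<close>
  have "\<exists>R \<phi>. subring_embedding R \<phi> \<and> countable R \<and> A \<subseteq> R"
    using assms
  proof (induction A)
    case empty
    have "countable (\<int> :: 'a set)"
      by (simp add: Ints_def)
    thus ?case
      using Ints_embedding by blast
  next
    case (insert x A)
    then obtain R \<phi> where "subring_embedding R \<phi>" "countable R" "A \<subseteq> R"
      by blast
    thus ?case
      using subring_embedding.adjoin[of R \<phi> x] by blast
  qed
  thus ?thesis
    using that by blast
qed

section \<open>The sum-product estimate over the complex numbers\<close>

text \<open>Vectors at an angle of at most 45 degrees differ by less than the longer one, unless one
  is zero. For \<open>(a, b)\<close> and \<open>(c, d)\<close> the last two assumptions are the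
  opposite inequalities, squared and expanded.\<close>

lemma octant_separation:
  fixes a b c d :: real
  assumes "0 \<le> b" "b \<le> a" "0 \<le> d" "d \<le> c"
    and "2 * (a * c + b * d) \<le> a\<^sup>2 + b\<^sup>2" "2 * (a * c + b * d) \<le> c\<^sup>2 + d\<^sup>2"
  shows "a = 0 \<or> c = 0"
proof -
  have wlog: "p = 0 \<or> r = 0"
    if "0 \<le> q" "q \<le> p" "0 \<le> s" "s \<le> r" "p \<le> r" "2 * (p * r + q * s) \<le> p\<^sup>2 + q\<^sup>2"
      "2 * (p * r + q * s) \<le> r\<^sup>2 + s\<^sup>2" for p q r s :: real
  proof (rule ccontr)
    assume "\<not> ?thesis"
    hence pos: "0 < p" "0 < r"
      using that by auto
    have "p\<^sup>2 \<le> p * r"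
      unfolding power2_eq_square using that by (intro mult_left_mono) auto
    moreover have "q\<^sup>2 \<le> p\<^sup>2"
      using that by (intro power_mono) auto
    moreover have "0 \<le> q * s"
      using that by simp
    \<comment> \<open>In the chain \<open>p^2 + q^2 \<le> 2 p^2 \<le> 2 p r \<le> 2 (p r + q s)
      \<le> p^2 + q^2\<close> equality holds throughout. This forces \<open>r = p\<close> and
      \<open>s = 0\<close>, against the last assumption of \<open>wlog\<close>.\<close>
    ultimately have "p * r \<le> p\<^sup>2" "p\<^sup>2 \<le> p * r" "p\<^sup>2 \<le> q\<^sup>2" "q\<^sup>2 \<le> p\<^sup>2" "q * s \<le> 0" "0 \<le> q * s"
      using that(6) unfolding distrib_left by linarith+
    hence "p * r = p\<^sup>2" "q\<^sup>2 = p\<^sup>2" "q * s = 0"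
      by (auto intro: antisym)
    hence "r = p" "s = 0"
      using pos by (auto simp: power2_eq_square)
    thus False
      using that pos by (simp add: power2_eq_square)
  qed
  show ?thesis
    using wlog[of b a d c] wlog[of d c b a] assms by (cases "a \<le> c") (auto simp: mult.commute add.commute)
qed

text \<open>Reflections in the axes and the diagonal carry both points into the octant of
  \<open>octant_separation\<close>; agreement of the signs preserves their inner product.\<close>

lemma same_octant_cmod_diff:
  assumes "cmod u \<le> cmod (u - v)" "cmod v \<le> cmod (u - v)"
    and "Re u \<ge> 0 \<longleftrightarrow> Re v \<ge> 0" "Im u \<ge> 0 \<longleftrightarrow> Im v \<ge> 0"
    and "\<bar>Re u\<bar> \<ge> \<bar>Im u\<bar> \<longleftrightarrow> \<bar>Re v\<bar> \<ge> \<bar>Im v\<bar>"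
  shows "u = 0 \<or> v = 0"
proof -
  have "Re u * Re v = \<bar>Re u\<bar> * \<bar>Re v\<bar>" "Im u * Im v = \<bar>Im u\<bar> * \<bar>Im v\<bar>"
    using assms(3,4) by (auto simp: abs_if)
  moreover have "(cmod u)\<^sup>2 \<le> (cmod (u - v))\<^sup>2" "(cmod v)\<^sup>2 \<le> (cmod (u - v))\<^sup>2"
    using assms(1,2) by (auto intro!: power_mono)
  ultimately have ineqs: "2 * (\<bar>Re u\<bar> * \<bar>Re v\<bar> + \<bar>Im u\<bar> * \<bar>Im v\<bar>) \<le> \<bar>Re u\<bar>\<^sup>2 + \<bar>Im u\<bar>\<^sup>2"
    "2 * (\<bar>Re u\<bar> * \<bar>Re v\<bar> + \<bar>Im u\<bar> * \<bar>Im v\<bar>) \<le> \<bar>Re v\<bar>\<^sup>2 + \<bar>Im v\<bar>\<^sup>2"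
    by (simp_all add: cmod_power2 power2_diff)
  show ?thesis
  proof (cases "\<bar>Re u\<bar> \<ge> \<bar>Im u\<bar>")
    case True
    thus ?thesis
      using octant_separation[of "\<bar>Im u\<bar>" "\<bar>Re u\<bar>" "\<bar>Im v\<bar>" "\<bar>Re v\<bar>"] ineqs assms(5)
      by (auto simp: complex_eq_iff)
  next
    case False
    thus ?thesis
      using octant_separation[of "\<bar>Re u\<bar>" "\<bar>Im u\<bar>" "\<bar>Re v\<bar>" "\<bar>Im v\<bar>"] ineqs assms(5)
      by (auto simp: complex_eq_iff add.commute)
  qed
qed

text \<open>Each of the eight octants around \<open>p\<close> contains at most one point of
  \<open>L\<close> other than \<open>p\<close>, and \<open>p\<close> itself may be the ninth.
  Applied to discs whose radii are nearest-neighbour distances, this bounds how many share a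
  point.\<close>

lemma card_mutually_distant:
  fixes L :: "complex set"
  assumes "finite L"
    and dist: "\<And>l m. l \<in> L \<Longrightarrow> m \<in> L \<Longrightarrow> l \<noteq> m \<Longrightarrow> cmod (l - p) \<le> cmod (l - m)"
  shows "card L \<le> 9"
proof -
  define octant where "octant = (\<lambda>l. (Re (l - p) \<ge> 0, Im (l - p) \<ge> 0, \<bar>Re (l - p)\<bar> \<ge> \<bar>Im (l - p)\<bar>))"
  have "inj_on octant (L - {p})"
  proof (rule inj_onI, rule ccontr)
    fix l m assume lm: "l \<in> L - {p}" "m \<in> L - {p}" "octant l = octant m" "l \<noteq> m"
    hence "cmod (l - p) \<le> cmod ((l - p) - (m - p))" "cmod (m - p) \<le> cmod ((l - p) - (m - p))"
      using dist[of l m] dist[of m l] by (auto simp: norm_minus_commute)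
    thus False
      using same_octant_cmod_diff[of "l - p" "m - p"] lm by (auto simp: octant_def)
  qed
  hence "card (L - {p}) \<le> card (UNIV :: (bool \<times> bool \<times> bool) set)"
    by (intro card_inj_on_le[of octant]) auto
  also have "\<dots> = 8"
    by (simp add: card_UNIV_bool flip: UNIV_Times_UNIV)
  finally have "card (L - {p}) \<le> 8" .
  moreover have "card L \<le> card (insert p (L - {p}))"
    using assms(1) by (intro card_mono) auto
  moreover have "card (insert p (L - {p})) = Suc (card (L - {p}))"
    using assms(1) by (intro card_insert_disjoint) auto
  ultimately show ?thesis
    by linarith
qed

lemma nearest_neighbour:
  fixes L :: "'a :: metric_space set"
  assumes "finite L" "card L \<ge> 2"
  obtains nn where "\<And>l. l \<in> L \<Longrightarrow> nn l \<in> L" "\<And>l. l \<in> L \<Longrightarrow> nn l \<noteq> l"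
    "\<And>l m. l \<in> L \<Longrightarrow> m \<in> L \<Longrightarrow> m \<noteq> l \<Longrightarrow> dist l (nn l) \<le> dist l m"
proof -
  have "\<exists>m. m \<in> L \<and> m \<noteq> l \<and> (\<forall>m'\<in>L. m' \<noteq> l \<longrightarrow> dist l m \<le> dist l m')" if "l \<in> L" for l
  proof -
    have "L - {l} \<noteq> {}"
    proof
      assume "L - {l} = {}"
      hence "card L \<le> card {l}"
        by (intro card_mono) auto
      thus False
        using assms(2) by simp
    qed
    thus ?thesis
      using ex_is_arg_min_if_finite[of "L - {l}" "dist l"] assms(1)
      by (auto simp: is_arg_min_linorder)
  qed
  thus ?thesis
    using that by metis
qed

section \<open>Lines through the origin that are rich in points of the grid\<close>

text \<open>The points of \<open>A \<times> A\<close> on the line of slope \<open>l\<close> through the origin, given by their first coordinates.\<close>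

definition line_pts :: "'a :: field set \<Rightarrow> 'a \<Rightarrow> 'a set" where
  "line_pts A l = {a \<in> A. l * a \<in> A}"

lemma finite_line_pts [simp]: "finite A \<Longrightarrow> finite (line_pts A l)"
  by (simp add: line_pts_def)

lemma card_line_pts_le: "finite A \<Longrightarrow> card (line_pts A l) \<le> card A"
  by (auto simp: line_pts_def intro: card_mono)

lemma card_le_card_sumset:
  fixes A :: "'a :: cancel_ab_semigroup_add set"
  assumes "finite A"
  shows "card A \<le> card (A + A)"
proof (cases "A = {}")
  case False
  then obtain a where "a \<in> A"
    by auto
  thus ?thesis
    using assms by (intro card_inj_on_le[of "\<lambda>x. a + x"]) (auto simp: finite_set_plus)
qed auto

text \<open>The quotient is the slope of \<open>(a, l * a) + (b, m * b)\<close>; the first assumption says that \<open>a\<close> and \<open>b\<close>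
  enclose an angle of at most a right angle.\<close>

lemma slope_of_sum:
  assumes "Re (a * cnj b) \<ge> 0" "a \<noteq> 0"
  shows "cmod (l - (l * a + m * b) / (a + b)) \<le> cmod (l - m)"
proof -
  \<comment> \<open>The slope differs from \<open>l\<close> by
    \<open>(l - m) * (b / (a + b))\<close>, and the angle condition gives
    \<open>cmod b \<le> cmod (a + b)\<close>.\<close>
  have expand: "(cmod (a + b))\<^sup>2 = (cmod a)\<^sup>2 + (cmod b)\<^sup>2 + 2 * Re (a * cnj b)"
    by (simp add: cmod_power2 power2_sum algebra_simps)
  have "(cmod (a + b))\<^sup>2 > 0"
    using assms by (simp add: expand add_pos_nonneg)
  hence nz: "a + b \<noteq> 0"
    by auto
  have "(cmod b)\<^sup>2 \<le> (cmod (a + b))\<^sup>2"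
    using assms by (simp add: expand)
  hence "cmod b \<le> cmod (a + b)"
    by (rule power2_le_imp_le) simp
  hence "cmod b / cmod (a + b) \<le> 1"
    using nz by simp
  hence "cmod (l - m) * (cmod b / cmod (a + b)) \<le> cmod (l - m)"
    by (rule mult_left_le) simp
  moreover have "l - (l * a + m * b) / (a + b) = (l - m) * (b / (a + b))"
    using nz by (simp add: field_simps)
  ultimately show "cmod (l - (l * a + m * b) / (a + b)) \<le> cmod (l - m)"
    by (simp only: norm_mult norm_divide)
qed

text \<open>Double counting of triples \<open>(l, a, b)\<close> with \<open>a\<close> on the line
  \<open>l\<close> and \<open>b\<close> on its neighbour \<open>nn l\<close>. There are at least
  \<open>card L * k^2\<close> of them; a sum point and \<open>l\<close> determine the triple, and
  each sum point admits at most nine \<open>l\<close>.\<close>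

lemma rich_lines_bound:
  fixes A L :: "complex set"
  assumes A: "finite A" "0 \<notin> A" "\<And>a b. a \<in> A \<Longrightarrow> b \<in> A \<Longrightarrow> Re (a * cnj b) \<ge> 0"
    and L: "finite L" "\<And>l. l \<in> L \<Longrightarrow> k \<le> card (line_pts A l)"
  shows "card L * k\<^sup>2 \<le> 9 * (card (A + A))\<^sup>2"
proof (cases "card L \<ge> 2")
  \<comment> \<open>A single line has no neighbour, but
    \<open>k \<le> card A \<le> card (A + A)\<close> is enough.\<close>
  case False
  show ?thesis
  proof (cases "L = {}")
    case False
    then obtain l where "l \<in> L"
      by auto
    hence "k \<le> card (A + A)"
      using L card_line_pts_le[OF A(1), of l] card_le_card_sumset[OF A(1)] by (meson order_trans)
    hence "card L * k\<^sup>2 \<le> 1 * (card (A + A))\<^sup>2"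
      using \<open>\<not> card L \<ge> 2\<close> by (intro mult_mono power_mono) auto
    thus ?thesis
      by simp
  qed auto
next
  case True
  then obtain nn where nn: "\<And>l. l \<in> L \<Longrightarrow> nn l \<in> L" "\<And>l. l \<in> L \<Longrightarrow> nn l \<noteq> l"
    "\<And>l m. l \<in> L \<Longrightarrow> m \<in> L \<Longrightarrow> m \<noteq> l \<Longrightarrow> dist l (nn l) \<le> dist l m"
    using nearest_neighbour[OF L(1)] by blast
  define S where "S = A + A"
  have fin_S: "finite S"
    using A(1) by (simp add: S_def finite_set_plus)
  define T where "T = (SIGMA l:L. line_pts A l \<times> line_pts A (nn l))"
  define F where "F = (\<lambda>(l, a, b). ((a + b, l * a + nn l * b), l))"
  define near where "near = (\<lambda>(x, y). {l \<in> L. cmod (l - y / x) \<le> cmod (l - nn l)})"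
  \<comment> \<open>The lines \<open>l\<close> and \<open>nn l\<close> are distinct, so a vector
    splits uniquely into a sum of points on them.\<close>
  have "inj_on F T"
  proof (rule inj_onI, clarsimp simp: F_def T_def)
    fix l a b a' b'
    assume l: "l \<in> L" and eq: "a + b = a' + b'" "l * a + nn l * b = l * a' + nn l * b'"
    have "(nn l - l) * (b - b') = (l * a + nn l * b - (l * a' + nn l * b')) - l * (a + b - (a' + b'))"
      by (simp add: algebra_simps)
    also have "\<dots> = 0"
      using eq by simp
    finally show "a = a' \<and> b = b'"
      using nn(2)[OF l] eq(1) by simp
  qed
  hence "card T = card (F ` T)"
    by (simp add: card_image)
  also have "F ` T \<subseteq> Sigma (S \<times> S) near"
  proof (clarsimp simp: F_def T_def S_def near_def)
    fix l a b assume l: "l \<in> L" and ab: "a \<in> line_pts A l" "b \<in> line_pts A (nn l)"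
    hence mem: "a \<in> A" "b \<in> A" "l * a \<in> A" "nn l * b \<in> A"
      by (auto simp: line_pts_def)
    moreover from this have "cmod (l - (l * a + nn l * b) / (a + b)) \<le> cmod (l - nn l)"
      using A by (intro slope_of_sum) auto
    ultimately show "a + b \<in> A + A \<and> l * a + nn l * b \<in> A + A \<and>
        cmod (l - (l * a + nn l * b) / (a + b)) \<le> cmod (l - nn l)"
      by auto
  qed
  hence "card (F ` T) \<le> card (Sigma (S \<times> S) near)"
    using L(1) fin_S by (intro card_mono finite_SigmaI) (auto simp: near_def)
  also have "\<dots> = (\<Sum>Q\<in>S \<times> S. card (near Q))"
    using L(1) fin_S by (intro card_SigmaI) (auto simp: near_def)
  also have "\<dots> \<le> (\<Sum>Q\<in>S \<times> S. 9)"
  proof (rule sum_mono)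
    fix Q
    show "card (near Q) \<le> 9"
    proof (rule card_mutually_distant)
      show "finite (near Q)"
        using L(1) by (auto simp: near_def split: prod.split)
    next
      \<comment> \<open>The disc of \<open>l\<close> has radius
        \<open>dist l (nn l) \<le> dist l m\<close>, so the slope is no farther from
        \<open>l\<close> than \<open>m\<close> is.\<close>
      fix l m assume "l \<in> near Q" "m \<in> near Q" "l \<noteq> m"
      thus "cmod (l - snd Q / fst Q) \<le> cmod (l - m)"
        using nn(3)[of l m] by (auto simp: near_def dist_norm split: prod.splits)
    qed
  qed
  also have "\<dots> = 9 * (card S)\<^sup>2"
    by (simp add: card_cartesian_product power2_eq_square)
  finally have "card T \<le> 9 * (card S)\<^sup>2" .
  moreover have "card T = (\<Sum>l\<in>L. card (line_pts A l) * card (line_pts A (nn l)))"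
    using L(1) A(1) by (simp add: T_def card_cartesian_product)
  moreover have "(\<Sum>l\<in>L. k * k) \<le> (\<Sum>l\<in>L. card (line_pts A l) * card (line_pts A (nn l)))"
    using L(2) nn(1) by (intro sum_mono mult_mono) auto
  ultimately show ?thesis
    by (simp add: S_def power2_eq_square)
qed

section \<open>Multiplicative energy and level sets\<close>

text \<open>Summation by layers: \<open>r^2\<close> is at most the sum of \<open>2 k\<close> over
  \<open>1 \<le> k \<le> r\<close>, and interchanging sums weights each level set by
  \<open>2 k\<close>. The assumed bound \<open>M / k^2\<close> leaves \<open>2 M / k\<close>, a
  harmonic sum.\<close>

lemma sum_squares_le_of_level_sets:
  fixes r :: "'a \<Rightarrow> nat" and M :: real
  assumes "finite L" "\<And>l. l \<in> L \<Longrightarrow> r l \<le> n"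
    and "\<And>k. k \<in> {1..n} \<Longrightarrow> real (card {l \<in> L. k \<le> r l}) * (real k)\<^sup>2 \<le> M"
  shows "(\<Sum>l\<in>L. (real (r l))\<^sup>2) \<le> 2 * M * harm n"
proof -
  have sq: "(real m)\<^sup>2 \<le> (\<Sum>k=1..m. 2 * real k)" for m
    by (induction m) (auto simp: power2_eq_square algebra_simps)
  have "(\<Sum>l\<in>L. (real (r l))\<^sup>2) \<le> (\<Sum>l\<in>L. \<Sum>k | k \<in> {1..n} \<and> k \<le> r l. 2 * real k)"
  proof (rule sum_mono)
    fix l assume "l \<in> L"
    hence "{k \<in> {1..n}. k \<le> r l} = {1..r l}"
      using assms(2)[of l] by auto
    thus "(real (r l))\<^sup>2 \<le> (\<Sum>k | k \<in> {1..n} \<and> k \<le> r l. 2 * real k)"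
      using sq by simp
  qed
  also have "\<dots> = (\<Sum>k\<in>{1..n}. \<Sum>l | l \<in> L \<and> k \<le> r l. 2 * real k)"
    using assms(1) by (intro sum.swap_restrict) auto
  also have "\<dots> \<le> (\<Sum>k\<in>{1..n}. 2 * M * inverse (real k))"
  proof (rule sum_mono)
    fix k assume k: "k \<in> {1..n}"
    have "real (card {l \<in> L. k \<le> r l}) * (2 * real k) = 2 * (real (card {l \<in> L. k \<le> r l}) * (real k)\<^sup>2) * inverse (real k)"
      using k by (simp add: field_simps power2_eq_square)
    also have "\<dots> \<le> 2 * M * inverse (real k)"
      using assms(3)[OF k] by (intro mult_right_mono mult_left_mono) auto
    finally show "(\<Sum>l | l \<in> L \<and> k \<le> r l. 2 * real k) \<le> 2 * M * inverse (real k)"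
      by simp
  qed
  also have "\<dots> = 2 * M * harm n"
    by (simp add: harm_def sum_distrib_left)
  finally show ?thesis .
qed

lemma card_collisions:
  assumes "finite X"
  shows "card {(p, q) \<in> X \<times> X. f p = f q} = (\<Sum>y\<in>f ` X. (card {p \<in> X. f p = y})\<^sup>2)"
proof -
  have "{(p, q) \<in> X \<times> X. f p = f q} = (\<Union>y\<in>f ` X. {p \<in> X. f p = y} \<times> {p \<in> X. f p = y})"
    by auto
  also have "card \<dots> = (\<Sum>y\<in>f ` X. card ({p \<in> X. f p = y} \<times> {p \<in> X. f p = y}))"
    using assms by (intro card_UN_disjoint) auto
  finally show ?thesis
    by (simp add: card_cartesian_product power2_eq_square)
qed

text \<open>Cauchy-Schwarz over the fibres of \<open>f\<close>, whose squared sizes add up to the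
  number of collisions.\<close>

lemma card_image_collisions:
  assumes "finite X"
  shows "(real (card X))\<^sup>2 \<le> real (card {(p, q) \<in> X \<times> X. f p = f q}) * real (card (f ` X))"
proof -
  have "card X = (\<Sum>y\<in>f ` X. card {p \<in> X. f p = y})"
    using sum.group[OF assms, of "f ` X" f "\<lambda>_. 1 :: nat"] assms by simp
  hence "(real (card X))\<^sup>2 = (\<Sum>y\<in>f ` X. real (card {p \<in> X. f p = y}))\<^sup>2"
    by simp
  also have "\<dots> \<le> (\<Sum>y\<in>f ` X. (real (card {p \<in> X. f p = y}))\<^sup>2) * real (card (f ` X))"
    by (rule sum_squared_le_sum_of_squares)
  finally show ?thesis
    unfolding card_collisions[OF assms] by simp
qed

text \<open>Since \<open>a * b = c * d\<close> amounts to \<open>a / c = d / b\<close>, permuting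
  coordinates turns coincidences of products into coincidences of slopes. The points of slope
  \<open>l\<close> correspond to \<open>line_pts A l\<close>.\<close>

lemma multiplicative_energy_eq:
  fixes A :: "'a :: field set"
  assumes "finite A" "0 \<notin> A"
  shows "card {(p, q) \<in> (A \<times> A) \<times> (A \<times> A). fst p * snd p = fst q * snd q} =
    (\<Sum>l\<in>(\<lambda>p. snd p / fst p) ` (A \<times> A). (card (line_pts A l))\<^sup>2)"
proof -
  have nz: "a \<noteq> 0" if "a \<in> A" for a
    using that assms(2) by auto
  have fibre: "card {p \<in> A \<times> A. snd p / fst p = l} = card (line_pts A l)" for l
  proof (rule bij_betw_same_card)
    show "bij_betw fst {p \<in> A \<times> A. snd p / fst p = l} (line_pts A l)"
      by (intro bij_betwI[of _ _ _ "\<lambda>a. (a, l * a)"]) (auto simp: line_pts_def nz)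
  qed
  have "bij_betw (\<lambda>((a, b), (c, d)). ((c, a), (b, d)))
      {(p, q) \<in> (A \<times> A) \<times> (A \<times> A). fst p * snd p = fst q * snd q}
      {(p, q) \<in> (A \<times> A) \<times> (A \<times> A). snd p / fst p = snd q / fst q}"
    by (intro bij_betwI[of _ _ _ "\<lambda>((c, a), (b, d)). ((a, b), (c, d))"]) (auto simp: field_simps nz)
  hence "card {(p, q) \<in> (A \<times> A) \<times> (A \<times> A). fst p * snd p = fst q * snd q} =
      card {(p, q) \<in> (A \<times> A) \<times> (A \<times> A). snd p / fst p = snd q / fst q}"
    by (rule bij_betw_same_card)
  also have "\<dots> = (\<Sum>l\<in>(\<lambda>p. snd p / fst p) ` (A \<times> A). (card {p \<in> A \<times> A. snd p / fst p = l})\<^sup>2)"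
    using assms by (intro card_collisions) auto
  finally show ?thesis
    by (simp only: fibre)
qed

text \<open>\<open>harm n - ln n\<close> decreases from its value 1 at \<open>n = 1\<close>.\<close>

lemma harm_le_one_plus_ln:
  assumes "n > 0"
  shows "harm n \<le> 1 + ln (real n)"
proof -
  obtain m where "n = Suc m"
    using assms gr0_implies_Suc by blast
  thus ?thesis
    using decseqD[OF decseq_harm_diff_ln, of 0 m] by (simp add: harm_Suc harm_def)
qed

section \<open>The estimate in a quadrant and in the whole plane\<close>

lemma sum_product_in_quadrant:
  fixes A :: "complex set"
  assumes A: "finite A" "A \<noteq> {}" "0 \<notin> A" "\<And>a b. a \<in> A \<Longrightarrow> b \<in> A \<Longrightarrow> Re (a * cnj b) \<ge> 0"
  shows "real (card A) ^ 4 \<le> 18 * (real (card (A + A)))\<^sup>2 * real (card (A * A)) * (1 + ln (real (card A)))"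
proof -
  define L where "L = (\<lambda>p. snd p / fst p) ` (A \<times> A)"
  have "finite L"
    using A(1) by (simp add: L_def)
  define E where "E = (\<Sum>l\<in>L. (real (card (line_pts A l)))\<^sup>2)"
  have "real (card A) ^ 4 = (real (card (A \<times> A)))\<^sup>2"
    by (simp add: card_cartesian_product power_mult_distrib power4_eq_xxxx power2_eq_square)
  also have "\<dots> \<le> E * real (card ((\<lambda>p. fst p * snd p) ` (A \<times> A)))"
    using card_image_collisions[OF finite_cartesian_product[OF A(1) A(1)], of "\<lambda>p. fst p * snd p"]
    unfolding multiplicative_energy_eq[OF A(1,3)] E_def L_def by simp
  also have "(\<lambda>p. fst p * snd p) ` (A \<times> A) = A * A"
    by (force simp: set_times_def)
  finally have energy: "real (card A) ^ 4 \<le> E * real (card (A * A))" .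
  \<comment> \<open>The 9 of the disc count and the 2 of the layer sum make up the constant
    18.\<close>
  have "E \<le> 2 * (9 * (real (card (A + A)))\<^sup>2) * harm (card A)"
    unfolding E_def
  proof (rule sum_squares_le_of_level_sets)
    fix k
    have "card {l \<in> L. k \<le> card (line_pts A l)} * k\<^sup>2 \<le> 9 * (card (A + A))\<^sup>2"
      using A \<open>finite L\<close> by (intro rich_lines_bound) auto
    hence "real (card {l \<in> L. k \<le> card (line_pts A l)} * k\<^sup>2) \<le> real (9 * (card (A + A))\<^sup>2)"
      by (rule of_nat_mono)
    thus "real (card {l \<in> L. k \<le> card (line_pts A l)}) * (real k)\<^sup>2 \<le> 9 * (real (card (A + A)))\<^sup>2"
      by simp
  qed (use \<open>finite L\<close> card_line_pts_le[OF A(1)] in auto)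
  also have "\<dots> \<le> 2 * (9 * (real (card (A + A)))\<^sup>2) * (1 + ln (real (card A)))"
    using A by (intro mult_left_mono harm_le_one_plus_ln) (auto simp: card_gt_0_iff)
  finally have "E * real (card (A * A)) \<le>
      2 * (9 * (real (card (A + A)))\<^sup>2) * (1 + ln (real (card A))) * real (card (A * A))"
    by (rule mult_right_mono) simp
  with energy show ?thesis
    by (simp add: algebra_simps)
qed

text \<open>Removing 0 costs at most half of a set with at least two elements, and some quadrant
  keeps at least a quarter of the rest; hence the factor 8.\<close>

lemma large_quadrant:
  fixes A :: "complex set"
  assumes "finite A" "card A \<ge> 2"
  obtains B where "B \<subseteq> A" "B \<noteq> {}" "0 \<notin> B" "card A \<le> 8 * card B"
    "\<And>a b. a \<in> B \<Longrightarrow> b \<in> B \<Longrightarrow> Re (a * cnj b) \<ge> 0"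
proof -
  define Q where "Q = (\<lambda>s. {a \<in> A - {0}. (Re a \<ge> 0, Im a \<ge> 0) = s})"
  have "card A \<le> 2 * card (A - {0})"
    using assms by (simp add: card_Diff_singleton_if) arith
  also have "A - {0} = (\<Union>s\<in>UNIV. Q s)"
    by (auto simp: Q_def)
  also have "card \<dots> \<le> (\<Sum>s\<in>UNIV. card (Q s))"
    by (rule card_UN_le) simp
  finally have sum_Q: "card A \<le> 2 * (\<Sum>s\<in>UNIV. card (Q s))"
    by simp
  obtain s where "card A \<le> 8 * card (Q s)"
  proof (rule ccontr)
    assume "\<not> thesis"
    hence "\<And>s. 8 * card (Q s) < card A"
      using that by (metis not_less)
    hence "(\<Sum>s\<in>UNIV. 8 * card (Q s)) < (\<Sum>s\<in>(UNIV :: (bool \<times> bool) set). card A)"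
      by (intro sum_strict_mono) auto
    moreover have "(\<Sum>s\<in>(UNIV :: (bool \<times> bool) set). card A) = 4 * card A"
      by (simp flip: UNIV_Times_UNIV)
    ultimately show False
      using sum_Q by (simp flip: sum_distrib_left)
  qed
  moreover from this have "Q s \<noteq> {}"
    using assms(2) by auto
  moreover have "Re (a * cnj b) \<ge> 0" if "a \<in> Q s" "b \<in> Q s" for a b
  proof -
    have "0 \<le> Re a * Re b" "0 \<le> Im a * Im b"
      using that by (auto simp: Q_def zero_le_mult_iff)
    thus ?thesis
      by simp
  qed
  ultimately show ?thesis
    using that[of "Q s"] by (auto simp: Q_def)
qed

theorem sum_product_complex:
  fixes A :: "complex set"
  assumes "finite A" "card A \<ge> 2"
  shows "real (max (card (A + A)) (card (A * A)))
    \<ge> 1 / 61 * (real (card A) powr (4 / 3) / ln (real (card A)) powr (1 / 3))"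
proof -
  define n M where "n = real (card A)" and "M = real (max (card (A + A)) (card (A * A)))"
  obtain B where B: "B \<subseteq> A" "B \<noteq> {}" "0 \<notin> B" "card A \<le> 8 * card B"
    "\<And>a b. a \<in> B \<Longrightarrow> b \<in> B \<Longrightarrow> Re (a * cnj b) \<ge> 0"
    using large_quadrant[OF assms] by blast
  have fin: "finite B"
    using B(1) assms(1) finite_subset by blast
  have n: "n \<ge> 2"
    using assms by (simp add: n_def)
  have "ln n \<ge> ln 2"
    using n by simp
  \<comment> \<open>This absorbs the additive 1:
    \<open>1 + ln (card B) \<le> 1 + ln n \<le> 3 * ln n\<close>.\<close>
  hence ln_n: "ln n \<ge> 1 / 2"
    using ln2_ge_two_thirds by linarith
  have "1 \<le> card B"
    using B(2) fin by (simp add: Suc_le_eq card_gt_0_iff)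
  moreover have "card B \<le> card A"
    using B(1) assms(1) by (rule card_mono[rotated])
  ultimately have ln_B: "0 \<le> ln (real (card B))" "ln (real (card B)) \<le> ln n"
    by (auto simp: n_def)
  have "card (B + B) \<le> card (A + A)" "card (B * B) \<le> card (A * A)"
    using B(1) assms(1)
    by (intro card_mono set_plus_mono2 set_times_mono2 finite_set_plus finite_set_times; simp)+
  hence M: "real (card (B + B)) \<le> M" "real (card (B * B)) \<le> M"
    by (auto simp: M_def)
  have "(n / 8) ^ 4 \<le> real (card B) ^ 4"
    using B(4) by (intro power_mono) (auto simp: n_def)
  also have "\<dots> \<le> 18 * (real (card (B + B)))\<^sup>2 * real (card (B * B)) * (1 + ln (real (card B)))"
    by (rule sum_product_in_quadrant[OF fin B(2,3,5)])
  also have "\<dots> \<le> 18 * M\<^sup>2 * M * (3 * ln n)"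
    using M ln_B ln_n by (intro mult_mono power_mono) auto
  \<comment> \<open>Here \<open>221184 = 8 ^ 4 * 18 * 3\<close>, and 61 is the least integer whose
    cube is at least this.\<close>
  finally have "n ^ 4 \<le> 221184 * (M ^ 3 * ln n)"
    by (simp add: power_divide power2_eq_square power3_eq_cube)
  also have "\<dots> \<le> 61 ^ 3 * (M ^ 3 * ln n)"
    using ln_n by (intro mult_right_mono) (auto simp: M_def)
  finally have "n ^ 4 \<le> 61 ^ 3 * (M ^ 3 * ln n)" .
  hence "n ^ 4 / ln n \<le> (61 * M) ^ 3"
    using ln_n by (simp add: field_simps)
  moreover have "(n powr (4 / 3) / ln n powr (1 / 3)) ^ 3 = n ^ 4 / ln n"
    using n ln_n by (simp add: power_divide powr_power)
  ultimately have "(n powr (4 / 3) / ln n powr (1 / 3)) ^ 3 \<le> (61 * M) ^ 3"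
    by simp
  hence "n powr (4 / 3) / ln n powr (1 / 3) \<le> 61 * M"
    by (subst (asm) power_mono_iff) (auto simp: M_def)
  thus ?thesis
    by (simp add: n_def M_def)
qed

section \<open>Transfer to fields of characteristic zero\<close>

lemma (in subring_embedding) image_sumset_prodset:
  assumes "A \<subseteq> R"
  shows "\<phi> ` A + \<phi> ` A = \<phi> ` (A + A)" "\<phi> ` A * \<phi> ` A = \<phi> ` (A * A)"
proof -
  have "\<phi> a + \<phi> b = \<phi> (a + b)" "\<phi> a * \<phi> b = \<phi> (a * b)" if "a \<in> A" "b \<in> A" for a b
    using that assms by (simp_all add: subset_eq)
  thus "\<phi> ` A + \<phi> ` A = \<phi> ` (A + A)" "\<phi> ` A * \<phi> ` A = \<phi> ` (A * A)"
    by (fastforce simp: set_plus_def set_times_def)+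
qed

theorem theorem1p5:
  "sum_product_const > 0 \<and>
   (\<forall>A :: 'a :: field_char_0 set. finite A \<and> card A \<ge> 2 \<longrightarrow>
      real (max (card (A + A)) (card (A * A)))
        \<ge> sum_product_const * (real (card A) powr (4 / 3) / ln (real (card A)) powr (1 / 3)))"
proof -
  have "\<exists>c. c > 0 \<and> (\<forall>A :: complex set. finite A \<and> card A \<ge> 2 \<longrightarrow>
      real (max (card (A + A)) (card (A * A)))
        \<ge> c * (real (card A) powr (4 / 3) / ln (real (card A)) powr (1 / 3)))"
    using sum_product_complex by (intro exI[of _ "1 / 61"]) auto
  from someI_ex[OF this] have const_pos: "sum_product_const > 0"
    and const: "\<And>A :: complex set. finite A \<Longrightarrow> card A \<ge> 2 \<Longrightarrow>
      real (max (card (A + A)) (card (A * A)))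
        \<ge> sum_product_const * (real (card A) powr (4 / 3) / ln (real (card A)) powr (1 / 3))"
    unfolding sum_product_const_def[symmetric] by blast+
  have "real (max (card (A + A)) (card (A * A)))
      \<ge> sum_product_const * (real (card A) powr (4 / 3) / ln (real (card A)) powr (1 / 3))"
    if A: "finite A" "card A \<ge> 2" for A :: "'a set"
  proof -
    obtain R \<phi> where emb: "subring_embedding R \<phi>" and "A \<subseteq> R"
      using finite_subset_embeds_in_complex[OF A(1)] by blast
    have card_eq: "card (\<phi> ` A) = card A"
      using subring_embedding.inj_on_map[OF emb] \<open>A \<subseteq> R\<close> by (intro card_image) (rule inj_on_subset)
    \<comment> \<open>Injectivity keeps \<open>card A\<close>; for the sumset and product set it is
      enough that an image is never larger.\<close>
    have "card (\<phi> ` A + \<phi> ` A) \<le> card (A + A)" "card (\<phi> ` A * \<phi> ` A) \<le> card (A * A)"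
      unfolding subring_embedding.image_sumset_prodset[OF emb \<open>A \<subseteq> R\<close>]
      using A(1) by (auto intro!: card_image_le finite_set_plus finite_set_times)
    hence le: "real (max (card (\<phi> ` A + \<phi> ` A)) (card (\<phi> ` A * \<phi> ` A)))
        \<le> real (max (card (A + A)) (card (A * A)))"
      by (intro of_nat_mono max.mono)
    show ?thesis
      using order_trans[OF const[of "\<phi> ` A"] le] A card_eq by simp
  qed
  with const_pos show ?thesis
    by blast
qed

end
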